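(* Consider the Nicholson equation with one pair of delays $$x'(t)=\beta(t)\big(p\,x(t-\tau(t))\,e^{-a x(t-\sigma(t))}-\delta x(t)\big),\qquad t\ge t_0,$$ where $p,a,\delta\in(0,\infty)$, and $\beta,\sigma,\tau:[t_0,\infty)\to[0,\infty)$ are continuous and bounded with $\inf_{t\ge t_0}\beta(t)>0$. Assume $p>\delta$, let $K=\frac1a\log\frac p\delta$ be the positive equilibrium, and denote $$\zeta_M:=\limsup_{t\to\infty}\int_{t-\sigma(t)}^t\beta(s)\,ds.$$ Assume further that $$(e^{\delta\zeta_M}-1)\log\frac{p}{\delta}\le 1.$$ Then $K$ is globally attractive in $C_0^+$, i.e. $\lim_{t\to\infty}x(t)=K$ for every solution $x(t)$ with initial condition in $C_0^+$.
   Context: Let $\bar\tau=\max\{\sup_{t\ge t_0}\tau(t),\sup_{t\ge t_0}\sigma(t)\}$. The phase space is $C=C([-\bar\tau,0];\mathbb{R})$ with the supremum norm, and the set of admissible initial conditions is $C_0^+=\{\phi\in C:\phi(\theta)\ge 0\text{ for }\theta\in[-\bar\tau,0),\ \phi(0)>0\}$. The solution with initial condition $\phi\in C_0^+$ is the solution on $[t_0,\infty)$ with $x(t_0+\theta)=\phi(\theta)$ for $\theta\in[-\bar\tau,0]$; such solutions are defined and positive on $[t_0,\infty)$. *)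

theory Defs
  imports "HOL-Analysis.Analysis"
begin

definition max_delay :: "real \<Rightarrow> (real \<Rightarrow> real) \<Rightarrow> (real \<Rightarrow> real) \<Rightarrow> real" where
  "max_delay t0 \<tau> \<sigma> = max (SUP t\<in>{t0..}. \<tau> t) (SUP t\<in>{t0..}. \<sigma> t)"

text \<open>An element of the phase space \<open>C([-r, 0])\<close> is represented by a total function whose values
  outside \<open>[-r, 0]\<close> are irrelevant.\<close>

definition phase_space :: "real \<Rightarrow> (real \<Rightarrow> real) set" where
  "phase_space r = {\<phi>. continuous_on {-r..0} \<phi>}"

definition admissible_initial :: "real \<Rightarrow> (real \<Rightarrow> real) set" where
  "admissible_initial r = {\<phi> \<in> phase_space r. (\<forall>\<theta>\<in>{-r..<0}. 0 \<le> \<phi> \<theta>) \<and> 0 < \<phi> 0}"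

text \<open>Only the values of \<open>x\<close> on \<open>[t0 - r, \<infinity>)\<close>, with \<open>r\<close> the maximal delay, matter.
  At \<open>t = t0\<close> the derivative is the right derivative.\<close>

definition nicholson_solution ::
  "real \<Rightarrow> real \<Rightarrow> real \<Rightarrow> real \<Rightarrow> (real \<Rightarrow> real) \<Rightarrow> (real \<Rightarrow> real) \<Rightarrow> (real \<Rightarrow> real)
    \<Rightarrow> (real \<Rightarrow> real) \<Rightarrow> (real \<Rightarrow> real) \<Rightarrow> bool" where
  "nicholson_solution t0 p a \<delta> \<beta> \<tau> \<sigma> \<phi> x \<longleftrightarrow>
     (\<forall>\<theta>\<in>{- max_delay t0 \<tau> \<sigma>..0}. x (t0 + \<theta>) = \<phi> \<theta>) \<and>
     (\<forall>t\<ge>t0. (x has_real_derivative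
        \<beta> t * (p * x (t - \<tau> t) * exp (- a * x (t - \<sigma> t)) - \<delta> * x t)) (at t within {t0..}))"

definition nicholson_equilibrium :: "real \<Rightarrow> real \<Rightarrow> real \<Rightarrow> real" where
  "nicholson_equilibrium p a \<delta> = 1 / a * ln (p / \<delta>)"

lemma nicholson_equilibrium:
  assumes "0 < a" "0 < \<delta>" "\<delta> < p"
  shows "0 < nicholson_equilibrium p a \<delta>"
    and "p * nicholson_equilibrium p a \<delta> * exp (- a * nicholson_equilibrium p a \<delta>)
           - \<delta> * nicholson_equilibrium p a \<delta> = 0"
proof -
  show "0 < nicholson_equilibrium p a \<delta>"
    using assms by (simp add: nicholson_equilibrium_def)
  have "exp (- a * nicholson_equilibrium p a \<delta>) = \<delta> / p"
    using assms by (simp add: nicholson_equilibrium_def exp_minus)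
  then show "p * nicholson_equilibrium p a \<delta> * exp (- a * nicholson_equilibrium p a \<delta>)
           - \<delta> * nicholson_equilibrium p a \<delta> = 0"
    using assms by simp
qed

text \<open>The limit superior is taken in \<^typ>\<open>ereal\<close>; it is finite under the standing assumptions
  (lemma \<open>zeta_M_finite\<close>), so converting back to \<^typ>\<open>real\<close> loses nothing. Since \<open>\<sigma>\<close> is
  bounded, the interval of integration lies in \<open>[t0, \<infinity>)\<close> for all large \<open>t\<close>.\<close>

definition zeta_M :: "(real \<Rightarrow> real) \<Rightarrow> (real \<Rightarrow> real) \<Rightarrow> real" where
  "zeta_M \<beta> \<sigma> =
     real_of_ereal (Limsup at_top (\<lambda>t. ereal (integral {t - \<sigma> t..t} \<beta>)))"

lemma zeta_M_finite:
  fixes t0 :: real and \<beta> \<sigma> :: "real \<Rightarrow> real"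
  assumes cont: "continuous_on {t0..} \<beta>"
    and nonneg: "\<And>t. t0 \<le> t \<Longrightarrow> 0 \<le> \<beta> t" "\<And>t. t0 \<le> t \<Longrightarrow> 0 \<le> \<sigma> t"
    and bdd: "bounded (\<beta> ` {t0..})" "bounded (\<sigma> ` {t0..})"
  shows "ereal (zeta_M \<beta> \<sigma>) = Limsup at_top (\<lambda>t. ereal (integral {t - \<sigma> t..t} \<beta>))"
proof -
  let ?f = "\<lambda>t. integral {t - \<sigma> t..t} \<beta>"
  obtain B where B: "\<And>t. t0 \<le> t \<Longrightarrow> \<bar>\<beta> t\<bar> \<le> B"
    using bdd(1) by (auto simp: bounded_iff)
  obtain S where S: "\<And>t. t0 \<le> t \<Longrightarrow> \<bar>\<sigma> t\<bar> \<le> S"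
    using bdd(2) by (auto simp: bounded_iff)
  have S0: "0 \<le> S" and B0: "0 \<le> B"
    using S[of t0] B[of t0] by auto
  have bounds: "0 \<le> ?f t \<and> ?f t \<le> B * S" if t: "t0 + S \<le> t" for t
  proof -
    have t0t: "t0 \<le> t" using t S0 by linarith
    have s: "0 \<le> \<sigma> t" "\<sigma> t \<le> S" using nonneg(2)[OF t0t] S[OF t0t] by auto
    have sub: "{t - \<sigma> t..t} \<subseteq> {t0..}" using t s by auto
    have int: "\<beta> integrable_on {t - \<sigma> t..t}"
      by (rule integrable_continuous_real) (rule continuous_on_subset[OF cont sub])
    have lo: "0 \<le> ?f t"
      using sub nonneg(1) by (intro integral_nonneg[OF int]) auto
    have "?f t \<le> integral {t - \<sigma> t..t} (\<lambda>_. B)"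
    proof (rule integral_le[OF int])
      show "(\<lambda>_. B) integrable_on {t - \<sigma> t..t}" by (rule integrable_const_ivl)
      show "\<beta> s \<le> B" if "s \<in> {t - \<sigma> t..t}" for s
        using that sub B[of s] by auto
    qed
    also have "\<dots> = \<sigma> t * B" using s by simp
    also have "\<dots> \<le> B * S" using s B0 by (simp add: mult.commute mult_left_mono)
    finally show ?thesis using lo by simp
  qed
  have ev: "eventually (\<lambda>t. t0 + S \<le> t) at_top" by (rule eventually_ge_at_top)
  have "Limsup at_top (\<lambda>t. ereal (?f t)) \<le> ereal (B * S)"
    by (rule Limsup_bounded, rule eventually_mono[OF ev]) (use bounds in auto)
  moreover have "0 \<le> Limsup at_top (\<lambda>t. ereal (?f t))"
    by (rule le_Limsup, simp, rule eventually_mono[OF ev]) (use bounds in auto)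
  ultimately show ?thesis
    unfolding zeta_M_def by (intro ereal_real') auto
qed

definition globally_attractive ::
  "(real \<Rightarrow> real) set \<Rightarrow> ((real \<Rightarrow> real) \<Rightarrow> (real \<Rightarrow> real) \<Rightarrow> bool) \<Rightarrow> real \<Rightarrow> bool" where
  "globally_attractive S sol K \<longleftrightarrow> (\<forall>\<phi>\<in>S. \<forall>x. sol \<phi> x \<longrightarrow> (x \<longlongrightarrow> K) at_top)"

end

theory Submission
  imports Defs
begin

text \<open>Let \<open>l \<le> L\<close> be the inferior and superior limits of a solution; both are positive and finite.
  Pick times \<open>t \<rightarrow> \<infinity>\<close> with \<open>x t \<rightarrow> L\<close> and \<open>x' t\<close> asymptotically nonnegative. Since
  \<open>x (t - \<tau> t)\<close> is asymptotically at most \<open>L\<close>, the equation forces \<open>x (t - \<sigma> t)\<close> to be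
  asymptotically at most \<open>K\<close>, whatever \<open>\<tau>\<close> is. On \<open>[t - \<sigma> t, t]\<close> the solution relaxes
  towards a level that is at most \<open>L * exp (a * (K - l))\<close>, which gives, with \<open>c = exp (\<delta> * \<zeta>) - 1\<close>,
  either \<open>L \<le> K\<close> or \<open>L * (1 + c - c * exp (a * (K - l))) \<le> K\<close>, and symmetrically for \<open>l\<close>.
  For \<open>v = a * (K - l)\<close>, \<open>w = a * (L - K)\<close> and \<open>c * a * K \<le> 1\<close> the two inequalities add up to
  \<open>1 / v + 1 / w \<ge> 1 / (1 - exp (- w)) + 1 / (exp v - 1)\<close>, while \<open>2 * tanh (z / 2) < z\<close> for
  \<open>z > 0\<close> gives the reverse strict inequality.\<close>

section \<open>Real analysis\<close>

text \<open>Divided by \<open>exp v + 1\<close>, this is \<open>2 * tanh (v / 2) < v\<close>. The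
  difference \<open>g\<close> of the two sides vanishes at 0 and increases, because
  \<open>1 - z < exp (- z)\<close>.\<close>

lemma half_tanh_less:
  fixes v :: real
  assumes "0 < v"
  shows "2 * (exp v - 1) < v * (exp v + 1)"
proof -
  define g where "g z = z * (exp z + 1) - 2 * (exp z - 1)" for z :: real
  have "g 0 < g v"
  proof (rule DERIV_pos_imp_increasing_open[OF assms])
    fix z :: real assume z: "0 < z"
    have "(g has_real_derivative 1 + (z - 1) * exp z) (at z)"
      unfolding g_def by (auto intro!: derivative_eq_intros simp: algebra_simps)
    moreover have "0 < 1 + (z - 1) * exp z"
    proof -
      have "1 - z < exp (- z)" using z by (simp add: exp_minus_greater)
      then have "(1 - z) * exp z < exp (- z) * exp z" by simp
      then show ?thesis by (simp add: exp_minus algebra_simps)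
    qed
    ultimately show "\<exists>y. (g has_real_derivative y) (at z) \<and> 0 < y" by blast
  qed (auto simp: g_def intro!: continuous_intros)
  then show ?thesis by (simp add: g_def)
qed

text \<open>With \<open>\<a>\<close>\<close>
lemma no_two_cycle:
  fixes u c v w :: real
  assumes u: "0 < u" and c: "0 \<le> c" "c * u \<le> 1" and v: "0 < v" "v < u" and w: "0 < w"
    and up: "(u + w) * (1 + c - c * exp v) \<le> u"
    and lo: "u \<le> (u - v) * (1 + c - c * exp (- w))"
  shows False
proof -
  define y where "y = 1 - exp (- w)"
  have y: "0 < y" "y < 1" using w by (auto simp: y_def)
  define z where "z = exp v - 1"
  have z: "0 < z" using v by (auto simp: z_def)
  have "u \<le> (u - v) * (1 + c * y)" using lo by (simp add: y_def algebra_simps)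
  \<comment> \<open>The factor \<open>u\<close> brings out the product \<open>c * u\<close>, which
    can then be replaced by its bound 1; the same device yields \<open>up'\<close>.\<close>
  then have "u * u \<le> (u - v) * (u + (c * u) * y)"
    using mult_left_mono[of u "(u - v) * (1 + c * y)" u] u by (simp add: algebra_simps)
  also have "\<dots> \<le> (u - v) * (u + 1 * y)"
    using c v y by (intro mult_left_mono add_left_mono mult_right_mono) auto
  finally have lo': "v * (u + y) \<le> u * y" by (simp add: algebra_simps)
  have up1: "(u + w) * (1 - c * z) \<le> u" using up by (simp add: z_def algebra_simps)
  have "(u + w) * (u - 1 * z) \<le> (u + w) * (u - (c * u) * z)"
    using c z u w by (intro mult_left_mono diff_left_mono mult_right_mono) auto
  also have "\<dots> \<le> u * u"
    using mult_left_mono[OF up1, of u] u by (simp add: algebra_simps)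
  finally have up': "w * (u - z) \<le> u * z" by (simp add: algebra_simps)
  \<comment> \<open>Both inequalities are linear in the reciprocals, and \<open>1 / u\<close>
    cancels when they are added.\<close>
  have "1 / v \<ge> 1 / u + 1 / y" using lo' u v y by (simp add: field_simps)
  moreover have "1 / w \<ge> 1 / z - 1 / u" using up' u w z by (simp add: field_simps)
  \<comment> \<open>Here \<open>1 / y = 1 + 1 / (exp w - 1)\<close>; the extra 1 turns the
    \<open>- 1 / 2\<close> of the tanh inequality into \<open>+ 1 / 2\<close>, which cancels against
    the \<open>- 1 / 2\<close> in the bound for \<open>1 / z\<close>.\<close>
  moreover have "1 / y > 1 / w + 1 / 2"
  proof -
    have "1 / y = exp w / (exp w - 1)" by (simp add: y_def exp_minus field_simps)
    moreover have "exp w \<noteq> 1" using w by simp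
    ultimately have "1 / y = 1 + 1 / (exp w - 1)" by (simp add: field_simps)
    moreover have "1 / (exp w - 1) > 1 / w - 1 / 2"
      using half_tanh_less[OF w] w by (simp add: field_simps)
    ultimately show ?thesis by linarith
  qed
  moreover have "1 / z > 1 / v - 1 / 2"
    using half_tanh_less[OF v(1)] v z by (simp add: z_def field_simps)
  ultimately show False by linarith
qed

section \<open>Derivatives at one-sided extrema and linear comparison\<close>

text \<open>A negative derivative would give larger values just left of \<open>m\<close>. Only the
  left side is compared, so a maximum at the right end of a compact interval is covered.\<close>

lemma deriv_nonneg_at_left_max:
  fixes f :: "real \<Rightarrow> real"
  assumes "(f has_real_derivative D) (at m)" "c < m" "\<And>s. c \<le> s \<Longrightarrow> s \<le> m \<Longrightarrow> f s \<le> f m"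
  shows "0 \<le> D"
proof (rule ccontr)
  assume "\<not> 0 \<le> D"
  then obtain d where d: "0 < d" "\<And>h. 0 < h \<Longrightarrow> h < d \<Longrightarrow> f m < f (m - h)"
    using DERIV_neg_dec_left[OF assms(1)] by auto
  define h where "h = min (d / 2) (m - c)"
  have "0 < h" "h < d" "c \<le> m - h" using d(1) assms(2) by (auto simp: h_def)
  then show False using d(2)[of h] assms(3)[of "m - h"] by simp
qed

lemma deriv_nonpos_at_left_min:
  fixes f :: "real \<Rightarrow> real"
  assumes "(f has_real_derivative D) (at m)" "c < m" "\<And>s. c \<le> s \<Longrightarrow> s \<le> m \<Longrightarrow> f m \<le> f s"
  shows "D \<le> 0"
  using deriv_nonneg_at_left_max[of "\<lambda>t. - f t" "- D" m c] assms
  by (auto intro: DERIV_minus)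

text \<open>With \<open>B\<close> the integral of \<open>b\<close> from \<open>s\<close>, the
  integrating factor \<open>exp (k * B)\<close> turns the differential inequality into monotonicity
  of \<open>(y - M) * exp (k * B)\<close>.\<close>

lemma relaxation_upper:
  fixes y b :: "real \<Rightarrow> real"
  assumes "s \<le> t" "continuous_on {s..t} y" "continuous_on {s..t} b"
    and deriv: "\<And>z. s < z \<Longrightarrow> z < t \<Longrightarrow> (y has_real_derivative y' z) (at z)"
    and le: "\<And>z. s < z \<Longrightarrow> z < t \<Longrightarrow> y' z \<le> k * b z * (M - y z)"
  shows "y t \<le> M + (y s - M) * exp (- k * integral {s..t} b)"
proof -
  define B where "B z = integral {s..z} b" for z
  have B: "(B has_real_derivative b z) (at z within {s..t})" if "z \<in> {s..t}" for z
    unfolding B_def by (rule integral_has_real_derivative[OF assms(3) that])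
  have contB: "continuous_on {s..t} B"
    using B by (rule DERIV_continuous_on)
  define g where "g z = (y z - M) * exp (k * B z)" for z
  have "g t \<le> g s"
  proof (rule DERIV_nonpos_imp_decreasing_open[OF assms(1)])
    fix z assume z: "s < z" "z < t"
    have "(B has_real_derivative b z) (at z)"
      using B[of z] z by (simp add: at_within_Icc_at)
    then have "(g has_real_derivative (y' z - k * b z * (M - y z)) * exp (k * B z)) (at z)"
      unfolding g_def using deriv[OF z]
      by (auto intro!: derivative_eq_intros simp: algebra_simps)
    then show "\<exists>d. (g has_real_derivative d) (at z) \<and> d \<le> 0"
      using le[OF z] by (intro exI conjI) (auto simp: mult_le_0_iff)
  qed (auto simp: g_def intro!: continuous_intros assms contB)
  then have "(y t - M) * exp (k * B t) \<le> y s - M" by (simp add: g_def B_def)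
  then have "(y t - M) * exp (k * B t) * exp (- k * B t) \<le> (y s - M) * exp (- k * B t)"
    by (rule mult_right_mono) simp
  then show ?thesis by (simp add: B_def mult.assoc flip: exp_add)
qed

lemma relaxation_lower:
  fixes y b :: "real \<Rightarrow> real"
  assumes "s \<le> t" "continuous_on {s..t} y" "continuous_on {s..t} b"
    and deriv: "\<And>z. s < z \<Longrightarrow> z < t \<Longrightarrow> (y has_real_derivative y' z) (at z)"
    and le: "\<And>z. s < z \<Longrightarrow> z < t \<Longrightarrow> k * b z * (M - y z) \<le> y' z"
  shows "M + (y s - M) * exp (- k * integral {s..t} b) \<le> y t"
proof -
  have "- y t \<le> - M + (- y s - - M) * exp (- k * integral {s..t} b)"
  proof (rule relaxation_upper[where y' = "\<lambda>z. - y' z"])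
    show "- y' z \<le> k * b z * (- M - - y z)" if "s < z" "z < t" for z
      using le[OF that] by (simp add: algebra_simps)
  qed (auto intro!: assms continuous_intros DERIV_minus)
  then show ?thesis by (simp add: algebra_simps)
qed

lemma exp_decay_lower_bound:
  fixes y b :: "real \<Rightarrow> real"
  assumes "s \<le> t" "continuous_on {s..t} y" "continuous_on {s..t} b"
    and "\<And>z. s < z \<Longrightarrow> z < t \<Longrightarrow> (y has_real_derivative y' z) (at z)"
    and "\<And>z. s < z \<Longrightarrow> z < t \<Longrightarrow> - k * b z * y z \<le> y' z"
  shows "y s * exp (- k * integral {s..t} b) \<le> y t"
  using relaxation_lower[of s t y b y' k 0] assms by simp

section \<open>Almost critical times and real-valued limits at infinity\<close>

text \<open>Otherwise, at late times, \<open>f\<close> falls with slope below \<open>- e\<close>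
  whenever it exceeds \<open>L - e\<close>. It can then never climb back above that level, so, being
  above it at arbitrarily late times, it stays above; but such a descent must cross the
  level.\<close>

lemma frequently_almost_critical_sup:
  fixes f f' :: "real \<Rightarrow> real"
  assumes deriv: "\<And>t. T0 < t \<Longrightarrow> (f has_real_derivative f' t) (at t)"
    and freq: "\<exists>\<^sub>F t in at_top. L - e < f t" and e: "0 < e"
  shows "\<exists>\<^sub>F t in at_top. L - e < f t \<and> - e \<le> f' t"
proof (rule ccontr)
  assume "\<not> ?thesis"
  then obtain T1 where T1: "\<And>t. T1 \<le> t \<Longrightarrow> L - e < f t \<Longrightarrow> f' t < - e"
    by (auto simp: not_frequently eventually_at_top_linorder not_le)
  define T where "T = max T1 (T0 + 1)"
  have T: "f' t < - e" if "T \<le> t" "L - e < f t" for t using that T1 by (auto simp: T_def)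
  have d: "(f has_real_derivative f' t) (at t)" if "T \<le> t" for t
    using that deriv[of t] by (auto simp: T_def)
  have cont: "continuous_on {s..t} f" if "T \<le> s" for s t
    using that by (auto intro!: continuous_at_imp_continuous_on DERIV_isCont[OF d])
  have above: "L - e < f t" if t: "T \<le> t" for t
  proof (rule ccontr)
    assume no: "\<not> L - e < f t"
    obtain t3 where t3: "t \<le> t3" "L - e < f t3"
      using freq by (auto simp: frequently_def eventually_at_top_linorder)
    obtain m where m: "m \<in> {t..t3}" "\<And>s. s \<in> {t..t3} \<Longrightarrow> f s \<le> f m"
      using continuous_attains_sup[of "{t..t3}" f] cont[OF t] t3 by auto
    have fm: "L - e < f m" using m(2)[of t3] t3 by auto
    then have "t < m" using no m(1) by (cases "t = m") auto
    then have "0 \<le> f' m"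
      by (intro deriv_nonneg_at_left_max[OF d, of m t]) (use t m in auto)
    then show False using T[of m] fm t m e by auto
  qed
  \<comment> \<open>The time at which a descent from \<open>f T\<close> with slope
    \<open>- e\<close> reaches the level \<open>L - e\<close>.\<close>
  define t where "t = T + (f T - L + e) / e"
  have fT: "0 < f T - L + e" using above[of T] by simp
  then have t: "T < t" using e by (simp add: t_def)
  obtain z where z: "T < z" "z < t" "f t - f T = (t - T) * f' z"
    using MVT2[OF t, of f f'] d by auto
  have "(t - T) * f' z \<le> (t - T) * (- e)"
    using z T[of z] above[of z] by (intro mult_left_mono) auto
  also have "\<dots> = - (f T - L + e)" using e by (simp add: t_def)
  finally show False using z(3) above[of t] t by simp
qed

lemma frequently_almost_critical_inf:
  fixes f f' :: "real \<Rightarrow> real"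
  assumes "\<And>t. T0 < t \<Longrightarrow> (f has_real_derivative f' t) (at t)"
    and "\<exists>\<^sub>F t in at_top. f t < l + e" and "0 < e"
  shows "\<exists>\<^sub>F t in at_top. f t < l + e \<and> f' t \<le> e"
proof -
  have "\<exists>\<^sub>F t in at_top. - l - e < - f t \<and> - e \<le> - f' t"
  proof (rule frequently_almost_critical_sup)
    show "((\<lambda>t. - f t) has_real_derivative - f' t) (at t)" if "T0 < t" for t
      by (rule DERIV_minus[OF assms(1)[OF that]])
    show "\<exists>\<^sub>F t in at_top. - l - e < - f t"
      using assms(2) by (rule frequently_elim1) simp
  qed fact
  then show ?thesis by (rule frequently_elim1) auto
qed

text \<open>The infimum of the eventual upper bounds is the limit superior as a real number; the
  epsilon properties are the form in which the later estimates use it.\<close>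

lemma real_limsup_exists:
  fixes f :: "real \<Rightarrow> real"
  assumes "\<forall>\<^sub>F t in at_top. m \<le> f t" "\<forall>\<^sub>F t in at_top. f t \<le> M"
  obtains L where "m \<le> L" "\<And>e. 0 < e \<Longrightarrow> \<forall>\<^sub>F t in at_top. f t < L + e"
    "\<And>e. 0 < e \<Longrightarrow> \<exists>\<^sub>F t in at_top. L - e < f t"
proof -
  define S where "S = {c. \<forall>\<^sub>F t in at_top. f t \<le> c}"
  have ne: "S \<noteq> {}" using assms(2) by (auto simp: S_def)
  have low: "m \<le> c" if "c \<in> S" for c
  proof -
    have "\<forall>\<^sub>F t :: real in at_top. m \<le> c"
      using assms(1) that unfolding S_def mem_Collect_eq
      by eventually_elim simp
    then show ?thesis by simp
  qed
  then have bdd: "bdd_below S" by (auto simp: bdd_below_def)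
  show ?thesis
  proof (rule that[of "Inf S"])
    show "m \<le> Inf S" using low ne by (intro cInf_greatest)
  next
    fix e :: real assume "0 < e"
    then obtain c where "c \<in> S" "c < Inf S + e" using cInf_lessD[OF ne, of "Inf S + e"] by auto
    then show "\<forall>\<^sub>F t in at_top. f t < Inf S + e"
      unfolding S_def mem_Collect_eq by (auto elim: eventually_mono)
  next
    fix e :: real assume "0 < e"
    show "\<exists>\<^sub>F t in at_top. Inf S - e < f t"
    proof (rule ccontr)
      assume "\<not> ?thesis"
      then have "Inf S - e \<in> S" by (simp add: not_frequently S_def not_less)
      then have "Inf S \<le> Inf S - e" by (intro cInf_lower bdd)
      then show False using \<open>0 < e\<close> by simp
    qed
  qed
qed

lemma real_liminf_exists:
  fixes f :: "real \<Rightarrow> real"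
  assumes "\<forall>\<^sub>F t in at_top. m \<le> f t" "\<forall>\<^sub>F t in at_top. f t \<le> M"
  obtains l where "m \<le> l" "\<And>e. 0 < e \<Longrightarrow> \<forall>\<^sub>F t in at_top. l - e < f t"
    "\<And>e. 0 < e \<Longrightarrow> \<exists>\<^sub>F t in at_top. f t < l + e"
proof (rule real_limsup_exists[of "- M" "\<lambda>t. - f t" "- m"])
  fix L
  assume L: "\<And>e. 0 < e \<Longrightarrow> \<forall>\<^sub>F t in at_top. - f t < L + e"
    "\<And>e. 0 < e \<Longrightarrow> \<exists>\<^sub>F t in at_top. L - e < - f t"
  have freq: "\<exists>\<^sub>F t in at_top. f t < - L + e" if "0 < e" for e
    using L(2)[OF that] by (rule frequently_elim1) simp
  show ?thesis
  proof (rule that[OF _ _ freq])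
    show "\<forall>\<^sub>F t in at_top. - L - e < f t" if "0 < e" for e
      using L(1)[OF that] by (rule eventually_mono) simp
    \<comment> \<open>The bound supplied for the limit superior of \<open>- f\<close> involves
      \<open>M\<close>, so this one is derived separately, from times with
      \<open>m \<le> f t\<close> and \<open>f t < - L + e\<close>.\<close>
    show "m \<le> - L"
    proof (rule field_le_epsilon)
      fix e :: real assume "0 < e"
      show "m \<le> - L + e"
        using frequently_ex[OF frequently_eventually_frequently[OF freq[OF \<open>0 < e\<close>] assms(1)]]
        by auto
    qed
  qed
qed (use assms in auto)

section \<open>Convex combinations and the algebra of the two limits\<close>

text \<open>\<open>M + (A - M) * E\<close> is affine in \<open>E\<close>, hence largest at an end of
  \<open>[E0, 1]\<close>, where it equals \<open>M + (A - M) * E0\<close> or \<open>A\<close>. In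
  the application the exponential factor is only known to lie in such an interval and the sign of
  \<open>A - M\<close> is open.\<close>

lemma le_max_convex_combination:
  fixes y :: real
  assumes "y \<le> M + (z - M) * E" "z \<le> A" "E0 \<le> E" "0 \<le> E" "E \<le> 1"
  shows "y \<le> max A (M + (A - M) * E0)"
proof -
  have "(z - M) * E \<le> (A - M) * E" using assms by (intro mult_right_mono) auto
  moreover have "(A - M) * E \<le> (A - M) * E0 \<or> (A - M) * E \<le> (A - M) * 1"
  proof (cases "A \<le> M")
    case True
    then show ?thesis using assms mult_left_mono_neg[of E0 E "A - M"] by simp
  next
    case False
    then show ?thesis using assms mult_left_mono[of E 1 "A - M"] by simp
  qed
  ultimately show ?thesis using assms(1) by auto
qed

lemma ge_min_convex_combination:
  fixes y :: real
  assumes "M + (z - M) * E \<le> y" "A \<le> z" "E0 \<le> E" "0 \<le> E" "E \<le> 1"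
  shows "min A (M + (A - M) * E0) \<le> y"
proof -
  have "- y \<le> max (- A) (- M + (- A - - M) * E0)"
    by (rule le_max_convex_combination[where z = "- z" and E = E])
      (use assms in \<open>auto simp: algebra_simps\<close>)
  then show ?thesis by (auto simp: algebra_simps)
qed

text \<open>If \<open>L \<le> u\<close>, the bracket in \<open>lo\<close> is at most 1 and forces
  \<open>u \<le> l\<close>; if \<open>u \<le> l\<close>, then \<open>up\<close> forces
  \<open>L \<le> u\<close>. Either way \<open>l \<le> L\<close> gives equality. The remaining case
  \<open>l < u < L\<close> is excluded by \<open>no_two_cycle\<close> with \<open>v = u - l\<close>
  and \<open>w = L - u\<close>.\<close>

lemma limits_collapse:
  fixes u c l L :: real
  assumes u: "0 < u" and c: "0 \<le> c" "c * u \<le> 1" and l: "0 < l" "l \<le> L"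
    and up: "L \<le> u \<or> L * (1 + c - c * exp (u - l)) \<le> u"
    and lo: "u \<le> l \<or> u \<le> l * (1 + c - c * exp (u - L))"
  shows "l = u" "L = u"
proof -
  have "u \<le> l" if "L \<le> u"
  proof (rule ccontr)
    assume no: "\<not> u \<le> l"
    have "1 \<le> exp (u - L)" using that by simp
    then have "l * (1 + c - c * exp (u - L)) \<le> l * 1"
      using c l mult_left_mono[of 1 "exp (u - L)" c] by (intro mult_left_mono) auto
    then show False using lo no by linarith
  qed
  moreover have "L \<le> u" if "u \<le> l"
  proof (rule ccontr)
    assume no: "\<not> L \<le> u"
    have "exp (u - l) \<le> 1" using that by simp
    then have "L * 1 \<le> L * (1 + c - c * exp (u - l))"
      using c l mult_left_mono[of "exp (u - l)" 1 c] by (intro mult_left_mono) auto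
    then show False using up no by linarith
  qed
  moreover have False if "u < L" "l < u"
    by (rule no_two_cycle[of u c "u - l" "L - u"]) (use that assms in auto)
  ultimately show "l = u" "L = u" using l by force+
qed

section \<open>Positive solutions are bounded and bounded away from zero\<close>

text \<open>\<open>r\<close> is a common bound of both delays. The equation is required only after
  \<open>t0 + r\<close>, when both delayed arguments lie beyond \<open>t0\<close>, so the initial
  function does not enter.\<close>

locale positive_nicholson_solution =
  fixes t0 r p a \<delta> b0 b1 :: real and \<beta> \<sigma> \<tau> x :: "real \<Rightarrow> real"
  assumes params: "0 < p" "0 < a" "0 < \<delta>" "\<delta> < p" "0 \<le> r" "0 < b0"
    and cont_\<beta>: "continuous_on {t0..} \<beta>"
    and \<beta>_ge: "\<And>t. t0 \<le> t \<Longrightarrow> b0 \<le> \<beta> t" and \<beta>_le: "\<And>t. t0 \<le> t \<Longrightarrow> \<beta> t \<le> b1"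
    and \<sigma>: "\<And>t. t0 \<le> t \<Longrightarrow> 0 \<le> \<sigma> t" "\<And>t. t0 \<le> t \<Longrightarrow> \<sigma> t \<le> r"
    and \<tau>: "\<And>t. t0 \<le> t \<Longrightarrow> 0 \<le> \<tau> t" "\<And>t. t0 \<le> t \<Longrightarrow> \<tau> t \<le> r"
    and pos: "\<And>t. t0 \<le> t \<Longrightarrow> 0 < x t"
    and cont_x: "continuous_on {t0..} x"
    and deriv_x: "\<And>t. t0 + r < t \<Longrightarrow> (x has_real_derivative
      \<beta> t * (p * x (t - \<tau> t) * exp (- a * x (t - \<sigma> t)) - \<delta> * x t)) (at t)"
begin

definition K where "K = nicholson_equilibrium p a \<delta>"

definition rate where
  "rate t = p * x (t - \<tau> t) * exp (- a * x (t - \<sigma> t)) - \<delta> * x t"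

lemma deriv: "t0 + r < t \<Longrightarrow> (x has_real_derivative \<beta> t * rate t) (at t)"
  using deriv_x by (simp add: rate_def)

lemma \<beta>_pos: "t0 \<le> t \<Longrightarrow> 0 < \<beta> t"
  using \<beta>_ge[of t] params by simp

lemma b1_pos: "0 < b1"
  using \<beta>_pos[of t0] \<beta>_le[of t0] by simp

lemma delayed_ge:
  assumes "s + r \<le> t" "t0 \<le> t"
  shows "s \<le> t - \<sigma> t" "s \<le> t - \<tau> t"
  using \<sigma>[of t] \<tau>[of t] assms by auto

lemma K_pos: "0 < K"
  unfolding K_def using params by (intro nicholson_equilibrium)

lemma exp_aK: "exp (a * K) = p / \<delta>"
  using params by (simp add: K_def nicholson_equilibrium_def)

lemma cont_on_Icc:
  assumes "t0 \<le> s"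
  shows "continuous_on {s..t} x" "continuous_on {s..t} \<beta>"
  using assms by (auto intro: continuous_on_subset[OF cont_x] continuous_on_subset[OF cont_\<beta>])

lemma integral_bounds:
  assumes "t0 \<le> s" "s \<le> t"
  shows "0 \<le> integral {s..t} \<beta>" "integral {s..t} \<beta> \<le> b1 * (t - s)"
proof -
  have i: "\<beta> integrable_on {s..t}"
    by (intro integrable_continuous_real cont_on_Icc assms)
  show "0 \<le> integral {s..t} \<beta>"
    using assms less_imp_le[OF \<beta>_pos] by (intro integral_nonneg[OF i]) auto
  have "integral {s..t} \<beta> \<le> integral {s..t} (\<lambda>_. b1)"
    by (intro integral_le[OF i integrable_const_ivl] \<beta>_le) (use assms in auto)
  then show "integral {s..t} \<beta> \<le> b1 * (t - s)" using assms by (simp add: mult.commute)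
qed

text \<open>The birth term is nonnegative, so \<open>x'\<close> is at least
  \<open>- \<delta> * \<beta> * x\<close>, and \<open>b1\<close> bounds the integral of
  \<open>\<beta>\<close>. Read backwards, this bounds earlier values by later ones.\<close>

lemma decay:
  assumes s: "t0 + r \<le> s" "s \<le> t"
  shows "x s * exp (- (\<delta> * b1 * (t - s))) \<le> x t"
proof -
  have s0: "t0 \<le> s" using s params by simp
  have "x s * exp (- (\<delta> * b1 * (t - s))) \<le> x s * exp (- \<delta> * integral {s..t} \<beta>)"
    using integral_bounds(2)[OF s0 s(2)] pos[OF s0] params by (simp add: mult.assoc)
  also have "\<dots> \<le> x t"
  proof (rule exp_decay_lower_bound[OF s(2) cont_on_Icc[OF s0]])
    fix z assume z: "s < z" "z < t"
    show "(x has_real_derivative \<beta> z * rate z) (at z)" using z s by (intro deriv) simp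
    have z0: "t0 \<le> z" using z s0 by simp
    have "0 < x (z - \<tau> z)" using delayed_ge[of t0 z] z z0 s by (intro pos) auto
    then have "- (\<delta> * x z) \<le> rate z" using params by (simp add: rate_def)
    then have "\<beta> z * - (\<delta> * x z) \<le> \<beta> z * rate z"
      using \<beta>_pos[OF z0] by (intro mult_left_mono) auto
    then show "- \<delta> * \<beta> z * x z \<le> \<beta> z * rate z" by (simp add: algebra_simps)
  qed
  finally show ?thesis .
qed

text \<open>A nonnegative rate means that births at least balance deaths. Replacing
  \<open>x (t - \<tau> t)\<close> by its bound \<open>x t\<close> lets \<open>x t\<close> cancel,
  which leaves \<open>exp (a * x (t - \<sigma> t)) \<le> p / \<delta>\<close>.\<close>

lemma le_K_at_record_max:
  assumes t: "t0 + r < t" and rate: "0 \<le> rate t" and le: "x (t - \<tau> t) \<le> x t"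
  shows "x (t - \<sigma> t) \<le> K"
proof -
  have x: "0 < x t" using t params by (intro pos) simp
  have "\<delta> * x t \<le> p * x (t - \<tau> t) * exp (- a * x (t - \<sigma> t))"
    using rate by (simp add: rate_def)
  also have "\<dots> \<le> p * x t * exp (- a * x (t - \<sigma> t))"
    using le params by (intro mult_right_mono mult_left_mono) auto
  finally have "exp (a * x (t - \<sigma> t)) \<le> exp (a * K)"
    using x params by (simp add: exp_aK exp_minus field_simps)
  then show ?thesis using params by simp
qed

lemma ge_K_at_record_min:
  assumes t: "t0 + r < t" and rate: "rate t \<le> 0" and ge: "x t \<le> x (t - \<tau> t)"
  shows "K \<le> x (t - \<sigma> t)"
proof -
  have x: "0 < x t" using t params by (intro pos) simp
  have "p * x t * exp (- a * x (t - \<sigma> t)) \<le> p * x (t - \<tau> t) * exp (- a * x (t - \<sigma> t))"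
    using ge params by (intro mult_right_mono mult_left_mono) auto
  also have "\<dots> \<le> \<delta> * x t"
    using rate by (simp add: rate_def)
  finally have "exp (a * K) \<le> exp (a * x (t - \<sigma> t))"
    using x params by (simp add: exp_aK exp_minus field_simps)
  then show ?thesis using params by simp
qed

text \<open>The weighted maximum of \<open>g\<close> on \<open>[s - r, t]\<close> cannot lie beyond
  \<open>s\<close>: there \<open>x'\<close> would be at least \<open>p * b1 * x\<close>, while the
  delayed value is at most the present one and the positive death term makes \<open>x'\<close>
  smaller. The factor \<open>exp (p * b1 * r)\<close> bounds the weight on
  \<open>[s - r, s]\<close>.\<close>

lemma growth:
  assumes s: "t0 + 2 * r \<le> s" "s \<le> t" and le: "\<And>z. s - r \<le> z \<Longrightarrow> z \<le> s \<Longrightarrow> x z \<le> c"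
  shows "x t \<le> c * exp (p * b1 * r) * exp (p * b1 * (t - s))"
proof -
  define g where "g z = x z * exp (- p * b1 * (z - s))" for z
  have "continuous_on {s - r..t} g" unfolding g_def
    using s params by (intro continuous_intros cont_on_Icc) auto
  then obtain m where m: "m \<in> {s - r..t}" "\<And>z. z \<in> {s - r..t} \<Longrightarrow> g z \<le> g m"
    using continuous_attains_sup[of "{s - r..t}" g] s params by auto
  have xg: "x z = g z * exp (p * b1 * (z - s))" for z
    by (simp add: g_def mult.assoc flip: exp_add)
  have "m \<le> s"
  proof (rule ccontr)
    assume "\<not> m \<le> s"
    then have ms: "s < m" by simp
    have m0: "t0 \<le> m" "t0 + r < m" using ms s params by auto
    have "(g has_real_derivative
        (\<beta> m * rate m - p * b1 * x m) * exp (- p * b1 * (m - s))) (at m)"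
      unfolding g_def using deriv[OF m0(2)]
      by (auto intro!: derivative_eq_intros simp: algebra_simps)
    then have "0 \<le> (\<beta> m * rate m - p * b1 * x m) * exp (- p * b1 * (m - s))"
      by (rule deriv_nonneg_at_left_max[of _ _ _ s]) (use ms m params in auto)
    then have ge: "p * b1 * x m \<le> \<beta> m * rate m"
      by (simp add: zero_le_mult_iff)
    have d: "s - r \<le> m - \<tau> m" "m - \<tau> m \<le> m" "t0 \<le> m - \<sigma> m" "t0 \<le> m - \<tau> m"
      using delayed_ge[of "s - r" m] delayed_ge[of t0 m] \<tau>(1)[OF m0(1)] ms m0 by auto
    have "x (m - \<tau> m) \<le> x m"
    proof -
      have "g (m - \<tau> m) \<le> g m" using d m by auto
      moreover have "exp (p * b1 * (m - \<tau> m - s)) \<le> exp (p * b1 * (m - s))"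
        using d params b1_pos by (simp add: mult_left_mono)
      ultimately show ?thesis unfolding xg using pos[OF m0(1)]
        by (intro mult_mono) (auto simp: g_def)
    qed
    then have "p * x (m - \<tau> m) * exp (- a * x (m - \<sigma> m)) \<le> p * x m * 1"
      using pos[OF d(3)] pos[OF d(4)] pos[OF m0(1)] params by (intro mult_mono) auto
    then have "rate m < p * x m"
      using mult_pos_pos[OF params(3) pos[OF m0(1)]] unfolding rate_def by linarith
    then have "\<beta> m * rate m < \<beta> m * (p * x m)"
      using \<beta>_pos[OF m0(1)] by (intro mult_strict_left_mono)
    also have "\<dots> \<le> b1 * (p * x m)"
      using \<beta>_le[OF m0(1)] params pos[OF m0(1)] by (intro mult_right_mono) auto
    finally show False using ge by (simp add: algebra_simps)
  qed
  then have "x m \<le> c" using le m by simp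
  moreover have "0 < x m" using m s params by (intro pos) auto
  moreover have "exp (- p * b1 * (m - s)) \<le> exp (p * b1 * r)"
  proof -
    have "p * b1 * (s - m) \<le> p * b1 * r"
      using m params b1_pos by (intro mult_left_mono) auto
    then show ?thesis by (simp add: algebra_simps)
  qed
  ultimately have "g m \<le> c * exp (p * b1 * r)" unfolding g_def
    by (intro mult_mono) auto
  then have "g t \<le> c * exp (p * b1 * r)" using m(2)[of t] s params by auto
  then show ?thesis unfolding xg[of t] by (intro mult_right_mono) auto
qed

text \<open>At a late running maximum \<open>m\<close>, the value at
  \<open>s = m - \<sigma> m\<close> is at most \<open>K\<close>. \<open>decay\<close> read backwards
  bounds \<open>x\<close> on \<open>[s - r, s]\<close>, and \<open>growth\<close> carries the bound
  forward to \<open>m\<close> over a time of at most \<open>r\<close>.\<close>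

lemma bounded_above: "\<exists>C. \<forall>t\<ge>t0. x t \<le> C"
proof -
  \<comment> \<open>Past \<open>t0 + 3 * r\<close> the point \<open>s\<close> lies beyond
    \<open>t0 + 2 * r\<close>, as \<open>growth\<close> requires, and \<open>[s - r, s]\<close> lies
    beyond \<open>t0 + r\<close>, as \<open>decay\<close> requires.\<close>
  obtain m0 where m0: "m0 \<in> {t0..t0 + 3 * r}" "\<And>z. z \<in> {t0..t0 + 3 * r} \<Longrightarrow> x z \<le> x m0"
    using continuous_attains_sup[of "{t0..t0 + 3 * r}" x] cont_on_Icc[of t0] params by auto
  define D where "D = K * exp (\<delta> * b1 * r) * exp (p * b1 * r) * exp (p * b1 * r)"
  have "x t \<le> max (x m0) D" if t: "t0 \<le> t" for t
  proof -
    obtain m where m: "m \<in> {t0..t}" "\<And>z. z \<in> {t0..t} \<Longrightarrow> x z \<le> x m"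
      using continuous_attains_sup[of "{t0..t}" x] cont_on_Icc[of t0] t by auto
    have "x m \<le> max (x m0) D"
    proof (cases "m \<le> t0 + 3 * r")
      case True
      then show ?thesis using m0(2)[of m] m by auto
    next
      case False
      then have mr: "t0 + 3 * r < m" by simp
      then have mr': "t0 + r < m" "t0 \<le> m" using params by auto
      have "0 \<le> \<beta> m * rate m"
        using deriv[OF mr'(1)] by (rule deriv_nonneg_at_left_max[of _ _ _ t0]) (use mr' params m in auto)
      then have "0 \<le> rate m" using \<beta>_pos[OF mr'(2)] by (simp add: zero_le_mult_iff)
      moreover have "x (m - \<tau> m) \<le> x m"
        using delayed_ge[of t0 m] mr' \<tau>(1)[of m] m by auto
      ultimately have K: "x (m - \<sigma> m) \<le> K" using le_K_at_record_max mr' by blast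
      define s where "s = m - \<sigma> m"
      have s: "t0 + 2 * r \<le> s" "s \<le> m" "m - s \<le> r"
        using delayed_ge(1)[of "t0 + 2 * r" m] mr mr' \<sigma>[of m] by (auto simp: s_def)
      have "x z \<le> K * exp (\<delta> * b1 * r)" if z: "s - r \<le> z" "z \<le> s" for z
      proof -
        have z0: "0 < x z" using z s params by (intro pos) auto
        have "\<delta> * b1 * (s - z) \<le> \<delta> * b1 * r"
          using z params b1_pos by (intro mult_left_mono) auto
        then have "x z * exp (- (\<delta> * b1 * r)) \<le> x z * exp (- (\<delta> * b1 * (s - z)))"
          using z0 by simp
        also have "\<dots> \<le> K" using decay[of z s] z s K by (simp add: s_def)
        finally show ?thesis by (simp add: exp_minus field_simps)
      qed
      then have "x m \<le> K * exp (\<delta> * b1 * r) * exp (p * b1 * r) * exp (p * b1 * (m - s))"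
        by (intro growth s)
      also have "\<dots> \<le> D" unfolding D_def
        using s K_pos params b1_pos by (intro mult_left_mono) auto
      finally show ?thesis by simp
    qed
    then show ?thesis using m(2)[of t] t by auto
  qed
  then show ?thesis by blast
qed

text \<open>At a late running minimum \<open>m\<close>, the value at \<open>m - \<sigma> m\<close>
  is at least \<open>K\<close>, and \<open>decay\<close> over a time of at most \<open>r\<close>
  cannot bring it below \<open>D\<close>.\<close>

lemma bounded_below: "\<exists>c>0. \<forall>t\<ge>t0. c \<le> x t"
proof -
  obtain m0 where m0: "m0 \<in> {t0..t0 + 2 * r}" "\<And>z. z \<in> {t0..t0 + 2 * r} \<Longrightarrow> x m0 \<le> x z"
    using continuous_attains_inf[of "{t0..t0 + 2 * r}" x] cont_on_Icc[of t0] params by auto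
  define D where "D = K * exp (- (\<delta> * b1 * r))"
  have "min (x m0) D \<le> x t" if t: "t0 \<le> t" for t
  proof -
    obtain m where m: "m \<in> {t0..t}" "\<And>z. z \<in> {t0..t} \<Longrightarrow> x m \<le> x z"
      using continuous_attains_inf[of "{t0..t}" x] cont_on_Icc[of t0] t by auto
    have "min (x m0) D \<le> x m"
    proof (cases "m \<le> t0 + 2 * r")
      case True
      then show ?thesis using m0(2)[of m] m by auto
    next
      case False
      then have mr: "t0 + 2 * r < m" by simp
      then have mr': "t0 + r < m" "t0 \<le> m" using params by auto
      have "\<beta> m * rate m \<le> 0"
        using deriv[OF mr'(1)] by (rule deriv_nonpos_at_left_min[of _ _ _ t0]) (use mr' params m in auto)
      then have "rate m \<le> 0" using \<beta>_pos[OF mr'(2)] by (simp add: mult_le_0_iff)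
      moreover have "x m \<le> x (m - \<tau> m)"
        using delayed_ge[of t0 m] mr' \<tau>(1)[of m] m by auto
      ultimately have K: "K \<le> x (m - \<sigma> m)" using ge_K_at_record_min mr' by blast
      have s: "t0 + r \<le> m - \<sigma> m" "0 \<le> \<sigma> m" "\<sigma> m \<le> r"
        using delayed_ge(1)[of "t0 + r" m] mr mr' \<sigma>[of m] by auto
      have "D \<le> x (m - \<sigma> m) * exp (- (\<delta> * b1 * \<sigma> m))" unfolding D_def
        using K K_pos s params b1_pos by (intro mult_mono) (auto intro!: mult_left_mono)
      also have "\<dots> \<le> x m" using decay[of "m - \<sigma> m" m] s by simp
      finally show ?thesis by simp
    qed
    then show ?thesis using m(2)[of t] t by auto
  qed
  moreover have "0 < min (x m0) D" using pos[of m0] m0(1) K_pos by (simp add: D_def)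
  ultimately show ?thesis by blast
qed

section \<open>Limit superior and limit inferior\<close>

text \<open>\<open>delayed_bound c e\<close> bounds \<open>x (t - \<sigma> t)\<close> when \<open>x t\<close> is within \<open>e\<close> of its limit superior
  (\<open>e > 0\<close>) or inferior (\<open>e < 0\<close>) \<open>c\<close> and \<open>x' t\<close> is at distance at most \<open>\<bar>e\<bar>\<close> on the wrong
  side of \<open>0\<close>; \<open>target c \<mu> e\<close> is the value towards which \<open>x\<close> then relaxes on \<open>[t - \<sigma> t, t]\<close>.\<close>

definition delayed_bound where
  "delayed_bound c e = - (1 / a) * ln ((\<delta> * (c - e) - e / b0) / (p * (c + e)))"

definition target where "target c \<mu> e = p / \<delta> * (c + e) * exp (- a * (\<mu> - e))"

text \<open>A general null function \<open>g\<close> covers both \<open>e\<close> and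
  \<open>- e\<close>. At perturbation 0 the level \<open>c\<close> cancels, leaving
  \<open>- (1 / a) * ln (\<delta> / p)\<close>.\<close>

lemma delayed_bound_tendsto:
  assumes "0 < c" "(g \<longlongrightarrow> 0) F"
  shows "((\<lambda>e. delayed_bound c (g e)) \<longlongrightarrow> K) F"
proof -
  have "((\<lambda>e. delayed_bound c (g e)) \<longlongrightarrow>
      - (1 / a) * ln ((\<delta> * (c - 0) - 0 / b0) / (p * (c + 0)))) F"
    unfolding delayed_bound_def by (intro tendsto_intros assms) (use assms params in auto)
  also have "- (1 / a) * ln ((\<delta> * (c - 0) - 0 / b0) / (p * (c + 0))) = K"
    using assms params by (simp add: K_def nicholson_equilibrium_def ln_div diff_divide_distrib)
  finally show ?thesis .
qed

lemma target_tendsto: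
  assumes "(g \<longlongrightarrow> 0) F"
  shows "((\<lambda>e. target c \<mu> (g e)) \<longlongrightarrow> c * exp (a * K - a * \<mu>)) F"
proof -
  have "((\<lambda>e. target c \<mu> (g e)) \<longlongrightarrow> p / \<delta> * (c + 0) * exp (- a * (\<mu> - 0))) F"
    unfolding target_def by (intro tendsto_intros assms) (use params in auto)
  then show ?thesis by (simp add: exp_diff exp_aK exp_minus field_simps)
qed

text \<open>The window \<open>2 * r\<close> reaches back by one delay to
  \<open>t - \<sigma> t\<close> and by a second delay from there.\<close>

lemma eventually_on_history:
  assumes "\<forall>\<^sub>F t in at_top. P t"
  shows "\<forall>\<^sub>F t in at_top. t0 + 2 * r < t \<and> (\<forall>z\<ge>t - 2 * r. P z)"
proof -
  obtain N where N: "\<And>z. N \<le> z \<Longrightarrow> P z"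
    using assms by (auto simp: eventually_at_top_linorder)
  show ?thesis
    using eventually_gt_at_top[of "t0 + 2 * r"] eventually_ge_at_top[of "N + 2 * r"]
    by eventually_elim (auto intro: N)
qed

text \<open>The bound is shown with slack \<open>e\<close> at a single almost critical time, then
  \<open>e\<close> tends to 0 from the right. The \<open>max\<close> arises because the integral of
  \<open>\<beta>\<close> is controlled only between 0 and \<open>\<zeta> + e\<close>.\<close>

lemma limsup_estimate:
  assumes \<zeta>: "\<And>e. 0 < e \<Longrightarrow> \<forall>\<^sub>F t in at_top. integral {t - \<sigma> t..t} \<beta> < \<zeta> + e"
    and L: "0 < L" "\<And>e. 0 < e \<Longrightarrow> \<forall>\<^sub>F t in at_top. x t < L + e"
      "\<And>e. 0 < e \<Longrightarrow> \<exists>\<^sub>F t in at_top. L - e < x t"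
    and l: "\<And>e. 0 < e \<Longrightarrow> \<forall>\<^sub>F t in at_top. l - e < x t"
  shows "L \<le> max K (L * exp (a * K - a * l) + (K - L * exp (a * K - a * l)) * exp (- \<delta> * \<zeta>))"
proof -
  \<comment> \<open>The second condition, true for all small \<open>e\<close>, keeps the argument of
    the logarithm in \<open>delayed_bound L e\<close> positive.\<close>
  have step: "L - e \<le> max (delayed_bound L e)
      (target L l e + (delayed_bound L e - target L l e) * exp (- \<delta> * (\<zeta> + e)))"
    if e: "0 < e" "0 < \<delta> * (L - e) - e / b0" for e
  proof -
    have "\<exists>\<^sub>F t in at_top. L - e < x t \<and> - e \<le> \<beta> t * rate t"
      by (rule frequently_almost_critical_sup[OF deriv L(3)[OF e(1)] e(1)])
    moreover note \<zeta>[OF e(1)]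
    moreover have "\<forall>\<^sub>F t in at_top. x t < L + e \<and> l - e < x t"
      using L(2)[OF e(1)] l[OF e(1)] by (rule eventually_conj)
    note eventually_on_history[OF this]
    ultimately have "\<exists>\<^sub>F t in at_top. ((L - e < x t \<and> - e \<le> \<beta> t * rate t)
        \<and> integral {t - \<sigma> t..t} \<beta> < \<zeta> + e)
        \<and> (t0 + 2 * r < t \<and> (\<forall>z\<ge>t - 2 * r. x z < L + e \<and> l - e < x z))"
      by (rule frequently_eventually_frequently[OF frequently_eventually_frequently])
    then obtain t where t: "L - e < x t" "- e \<le> \<beta> t * rate t"
        "integral {t - \<sigma> t..t} \<beta> < \<zeta> + e" "t0 + 2 * r < t"
        and hist: "\<And>z. t - 2 * r \<le> z \<Longrightarrow> x z < L + e" "\<And>z. t - 2 * r \<le> z \<Longrightarrow> l - e < x z"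
      using frequently_ex by blast
    have t0t: "t0 \<le> t" using t params by simp
    define s where "s = t - \<sigma> t"
    have s: "t0 + r < s" "s \<le> t" "t - r \<le> s" "t0 \<le> s"
      using \<sigma>[OF t0t] t params by (auto simp: s_def)
    \<comment> \<open>The lower bound \<open>b0\<close> of \<open>\<beta>\<close> converts the bound
      on the derivative into one on \<open>rate t\<close>.\<close>
    have "- (e / b0) \<le> rate t"
    proof (rule ccontr)
      assume no: "\<not> - (e / b0) \<le> rate t"
      then have neg: "rate t < 0" using e params by (smt (verit) divide_pos_pos)
      have "\<beta> t * rate t \<le> b0 * rate t" using neg \<beta>_ge[OF t0t] by (intro mult_right_mono_neg) auto
      also have "\<dots> < b0 * - (e / b0)" using no params by (intro mult_strict_left_mono) auto
      finally show False using t params by simp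
    qed
    moreover have "\<delta> * (L - e) \<le> \<delta> * x t" using t params by (intro mult_left_mono) auto
    ultimately have "\<delta> * (L - e) - e / b0 \<le> p * x (t - \<tau> t) * exp (- a * x s)"
      unfolding rate_def s_def by linarith
    also have "x (t - \<tau> t) \<le> L + e" using hist(1)[of "t - \<tau> t"] \<tau>[OF t0t] params by auto
    then have "p * x (t - \<tau> t) * exp (- a * x s) \<le> p * (L + e) * exp (- a * x s)"
      using params by (intro mult_right_mono mult_left_mono) auto
    finally have "(\<delta> * (L - e) - e / b0) / (p * (L + e)) \<le> exp (- a * x s)"
      using params L e by (subst pos_divide_le_eq) (auto simp: mult_ac)
    then have "ln ((\<delta> * (L - e) - e / b0) / (p * (L + e))) \<le> - a * x s"
      using e L params by (subst ln_le_cancel_iff[of _ "exp (- a * x s)", simplified ln_exp]) auto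
    then have xs: "x s \<le> delayed_bound L e"
      unfolding delayed_bound_def using params by (simp add: field_simps)
    have "x t \<le> target L l e + (x s - target L l e) * exp (- \<delta> * integral {s..t} \<beta>)"
    proof (rule relaxation_upper[OF s(2) cont_on_Icc[OF s(4)]])
      fix z assume z: "s < z" "z < t"
      have zr: "t0 + r < z" "t0 \<le> z" using z s by auto
      show "(x has_real_derivative \<beta> z * rate z) (at z)" by (rule deriv) fact
      have d: "t - 2 * r \<le> z - \<tau> z" "t - 2 * r \<le> z - \<sigma> z"
        using z s delayed_ge[of "t - 2 * r" z] zr by auto
      \<comment> \<open>Births on \<open>[s, t]\<close> are bounded through the extreme history
        values: above at the delay \<open>\<tau>\<close>, below at the delay
        \<open>\<sigma>\<close>.\<close>
      have "p * x (z - \<tau> z) * exp (- a * x (z - \<sigma> z)) \<le> p * (L + e) * exp (- a * (l - e))"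
        using hist(1)[OF d(1)] hist(2)[OF d(2)] params L e
        by (intro mult_mono mult_left_mono) auto
      also have "\<dots> = \<delta> * target L l e" using params by (simp add: target_def)
      finally have "rate z \<le> \<delta> * (target L l e - x z)" by (simp add: rate_def algebra_simps)
      then have "\<beta> z * rate z \<le> \<beta> z * (\<delta> * (target L l e - x z))"
        using \<beta>_pos[OF zr(2)] by (intro mult_left_mono) auto
      then show "\<beta> z * rate z \<le> \<delta> * \<beta> z * (target L l e - x z)" by (simp add: mult_ac)
    qed
    then have "x t \<le> max (delayed_bound L e)
      (target L l e + (delayed_bound L e - target L l e) * exp (- \<delta> * (\<zeta> + e)))"
      by (rule le_max_convex_combination)
        (use xs t(3) integral_bounds(1)[OF s(4,2)] params in \<open>auto simp: s_def\<close>)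
    then show ?thesis using t(1) by linarith
  qed
  have id: "((\<lambda>e. e) \<longlongrightarrow> (0::real)) (at_right 0)" by (rule tendsto_ident_at)
  have "((\<lambda>e. \<delta> * (L - e) - e / b0) \<longlongrightarrow> \<delta> * (L - 0) - 0 / b0) (at_right 0)"
    by (intro tendsto_intros id) (use params in auto)
  then have "\<forall>\<^sub>F e in at_right 0. 0 < \<delta> * (L - e) - e / b0"
    by (rule order_tendstoD) (use params L in simp)
  then have ev: "\<forall>\<^sub>F e in at_right 0. L - e \<le> max (delayed_bound L e)
      (target L l e + (delayed_bound L e - target L l e) * exp (- \<delta> * (\<zeta> + e)))"
    using eventually_at_right_less[of "0::real"] by eventually_elim (rule step)
  have lim1: "((\<lambda>e. L - e) \<longlongrightarrow> L - 0) (at_right 0)" by (intro tendsto_intros)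
  have db: "((\<lambda>e. delayed_bound L e) \<longlongrightarrow> K) (at_right 0)"
    by (rule delayed_bound_tendsto[OF L(1) id])
  have tg: "((\<lambda>e. target L l e) \<longlongrightarrow> L * exp (a * K - a * l)) (at_right 0)"
    by (rule target_tendsto[OF id])
  have ex: "((\<lambda>e. exp (- \<delta> * (\<zeta> + e))) \<longlongrightarrow> exp (- \<delta> * (\<zeta> + 0))) (at_right 0)"
    by (intro tendsto_intros)
  have lim2: "((\<lambda>e. max (delayed_bound L e)
      (target L l e + (delayed_bound L e - target L l e) * exp (- \<delta> * (\<zeta> + e)))) \<longlongrightarrow>
      max K (L * exp (a * K - a * l) + (K - L * exp (a * K - a * l)) * exp (- \<delta> * (\<zeta> + 0)))) (at_right 0)"
    by (intro tendsto_max tendsto_add tendsto_mult tendsto_diff db tg ex)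
  show ?thesis using tendsto_le[OF trivial_limit_at_right_real lim2 lim1 ev] by simp
qed

text \<open>Mirror image of \<open>limsup_estimate\<close>: all inequalities are reversed and the
  perturbation is \<open>- e\<close>.\<close>

lemma liminf_estimate:
  assumes \<zeta>: "\<And>e. 0 < e \<Longrightarrow> \<forall>\<^sub>F t in at_top. integral {t - \<sigma> t..t} \<beta> < \<zeta> + e"
    and l: "0 < l" "\<And>e. 0 < e \<Longrightarrow> \<forall>\<^sub>F t in at_top. l - e < x t"
      "\<And>e. 0 < e \<Longrightarrow> \<exists>\<^sub>F t in at_top. x t < l + e"
    and L: "\<And>e. 0 < e \<Longrightarrow> \<forall>\<^sub>F t in at_top. x t < L + e"
  shows "min K (l * exp (a * K - a * L) + (K - l * exp (a * K - a * L)) * exp (- \<delta> * \<zeta>)) \<le> l"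
proof -
  \<comment> \<open>\<open>e < l\<close> keeps \<open>l - e\<close> positive, for the division and
    the logarithm.\<close>
  have step: "min (delayed_bound l (- e)) (target l L (- e)
      + (delayed_bound l (- e) - target l L (- e)) * exp (- \<delta> * (\<zeta> + e))) \<le> l + e"
    if e: "0 < e" "e < l" for e
  proof -
    have "\<exists>\<^sub>F t in at_top. x t < l + e \<and> \<beta> t * rate t \<le> e"
      by (rule frequently_almost_critical_inf[OF deriv l(3)[OF e(1)] e(1)])
    moreover note \<zeta>[OF e(1)]
    moreover have "\<forall>\<^sub>F t in at_top. x t < L + e \<and> l - e < x t"
      using L[OF e(1)] l(2)[OF e(1)] by (rule eventually_conj)
    note eventually_on_history[OF this]
    ultimately have "\<exists>\<^sub>F t in at_top. ((x t < l + e \<and> \<beta> t * rate t \<le> e)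
        \<and> integral {t - \<sigma> t..t} \<beta> < \<zeta> + e)
        \<and> (t0 + 2 * r < t \<and> (\<forall>z\<ge>t - 2 * r. x z < L + e \<and> l - e < x z))"
      by (rule frequently_eventually_frequently[OF frequently_eventually_frequently])
    then obtain t where t: "x t < l + e" "\<beta> t * rate t \<le> e"
        "integral {t - \<sigma> t..t} \<beta> < \<zeta> + e" "t0 + 2 * r < t"
        and hist: "\<And>z. t - 2 * r \<le> z \<Longrightarrow> x z < L + e" "\<And>z. t - 2 * r \<le> z \<Longrightarrow> l - e < x z"
      using frequently_ex by blast
    have t0t: "t0 \<le> t" using t params by simp
    define s where "s = t - \<sigma> t"
    have s: "t0 + r < s" "s \<le> t" "t - r \<le> s" "t0 \<le> s"
      using \<sigma>[OF t0t] t params by (auto simp: s_def)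
    have "rate t \<le> e / b0"
    proof (rule ccontr)
      assume no: "\<not> rate t \<le> e / b0"
      then have pos: "0 < rate t" using e params by (smt (verit) divide_pos_pos)
      have "b0 * (e / b0) < b0 * rate t" using no params by (intro mult_strict_left_mono) auto
      also have "\<dots> \<le> \<beta> t * rate t" using pos \<beta>_ge[OF t0t] by (intro mult_right_mono) auto
      finally show False using t params by simp
    qed
    moreover have "\<delta> * x t \<le> \<delta> * (l + e)" using t params by (intro mult_left_mono) auto
    ultimately have "p * x (t - \<tau> t) * exp (- a * x s) \<le> \<delta> * (l + e) + e / b0"
      unfolding rate_def s_def by linarith
    moreover have "l - e \<le> x (t - \<tau> t)" using hist(2)[of "t - \<tau> t"] \<tau>[OF t0t] params by auto
    then have "p * (l - e) * exp (- a * x s) \<le> p * x (t - \<tau> t) * exp (- a * x s)"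
      using params by (intro mult_right_mono mult_left_mono) auto
    ultimately have "p * (l - e) * exp (- a * x s) \<le> \<delta> * (l + e) + e / b0" by linarith
    then have "exp (- a * x s) \<le> (\<delta> * (l + e) + e / b0) / (p * (l - e))"
      using params e by (subst pos_le_divide_eq) (auto simp: mult_ac)
    then have "- a * x s \<le> ln ((\<delta> * (l + e) + e / b0) / (p * (l - e)))"
      using e l params by (subst ln_ge_iff) (auto intro!: divide_pos_pos add_pos_pos)
    then have xs: "delayed_bound l (- e) \<le> x s"
      unfolding delayed_bound_def using params by (simp add: field_simps)
    have "target l L (- e) + (x s - target l L (- e)) * exp (- \<delta> * integral {s..t} \<beta>) \<le> x t"
    proof (rule relaxation_lower[OF s(2) cont_on_Icc[OF s(4)]])
      fix z assume z: "s < z" "z < t"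
      have zr: "t0 + r < z" "t0 \<le> z" using z s by auto
      show "(x has_real_derivative \<beta> z * rate z) (at z)" by (rule deriv) fact
      have d: "t - 2 * r \<le> z - \<tau> z" "t - 2 * r \<le> z - \<sigma> z"
        using z s delayed_ge[of "t - 2 * r" z] zr by auto
      have "\<delta> * target l L (- e) = p * (l - e) * exp (- a * (L + e))"
        using params by (simp add: target_def)
      also have "\<dots> \<le> p * x (z - \<tau> z) * exp (- a * x (z - \<sigma> z))"
        using hist(2)[OF d(1)] hist(1)[OF d(2)] params e
        by (intro mult_mono mult_left_mono) auto
      finally have "\<delta> * (target l L (- e) - x z) \<le> rate z" by (simp add: rate_def algebra_simps)
      then have "\<beta> z * (\<delta> * (target l L (- e) - x z)) \<le> \<beta> z * rate z"
        using \<beta>_pos[OF zr(2)] by (intro mult_left_mono) auto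
      then show "\<delta> * \<beta> z * (target l L (- e) - x z) \<le> \<beta> z * rate z" by (simp add: mult_ac)
    qed
    then have "min (delayed_bound l (- e)) (target l L (- e)
      + (delayed_bound l (- e) - target l L (- e)) * exp (- \<delta> * (\<zeta> + e))) \<le> x t"
      by (rule ge_min_convex_combination)
        (use xs t(3) integral_bounds(1)[OF s(4,2)] params in \<open>auto simp: s_def\<close>)
    then show ?thesis using t(1) by linarith
  qed
  have id: "((\<lambda>e. - e) \<longlongrightarrow> (0::real)) (at_right 0)"
    using tendsto_minus[OF tendsto_ident_at[of "0::real" "{0<..}"]] by simp
  have ev: "\<forall>\<^sub>F e in at_right 0. min (delayed_bound l (- e)) (target l L (- e)
      + (delayed_bound l (- e) - target l L (- e)) * exp (- \<delta> * (\<zeta> + e))) \<le> l + e"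
    using eventually_at_right_less[of "0::real"] eventually_at_right_real[OF l(1)]
    by eventually_elim (intro step; simp)
  have lim1: "((\<lambda>e. l + e) \<longlongrightarrow> l + 0) (at_right 0)" by (intro tendsto_intros)
  have db: "((\<lambda>e. delayed_bound l (- e)) \<longlongrightarrow> K) (at_right 0)"
    by (rule delayed_bound_tendsto[OF l(1) id])
  have tg: "((\<lambda>e. target l L (- e)) \<longlongrightarrow> l * exp (a * K - a * L)) (at_right 0)"
    by (rule target_tendsto[OF id])
  have ex: "((\<lambda>e. exp (- \<delta> * (\<zeta> + e))) \<longlongrightarrow> exp (- \<delta> * (\<zeta> + 0))) (at_right 0)"
    by (intro tendsto_intros)
  have lim2: "((\<lambda>e. min (delayed_bound l (- e)) (target l L (- e)
      + (delayed_bound l (- e) - target l L (- e)) * exp (- \<delta> * (\<zeta> + e)))) \<longlongrightarrow>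
      min K (l * exp (a * K - a * L) + (K - l * exp (a * K - a * L)) * exp (- \<delta> * (\<zeta> + 0)))) (at_right 0)"
    by (intro tendsto_min tendsto_add tendsto_mult tendsto_diff db tg ex)
  show ?thesis using tendsto_le[OF trivial_limit_at_right_real lim1 lim2 ev] by simp
qed

section \<open>Convergence to the equilibrium\<close>

text \<open>Multiplied by \<open>a\<close> and by \<open>exp (\<delta> * \<zeta>) = 1 + c\<close>,
  the two estimates become the hypotheses of \<open>limits_collapse\<close> with
  \<open>u = a * K = ln (p / \<delta>)\<close>; the smallness condition reads
  \<open>c * u \<le> 1\<close>.\<close>

lemma tendsto_K:
  assumes \<zeta>: "\<And>e. 0 < e \<Longrightarrow> \<forall>\<^sub>F t in at_top. integral {t - \<sigma> t..t} \<beta> < \<zeta> + e"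
    and small: "0 \<le> \<zeta>" "(exp (\<delta> * \<zeta>) - 1) * ln (p / \<delta>) \<le> 1"
  shows "(x \<longlongrightarrow> K) at_top"
proof -
  obtain m where m: "0 < m" "\<And>t. t0 \<le> t \<Longrightarrow> m \<le> x t" using bounded_below by blast
  obtain M where M: "\<And>t. t0 \<le> t \<Longrightarrow> x t \<le> M" using bounded_above by blast
  have evm: "\<forall>\<^sub>F t in at_top. m \<le> x t"
    using eventually_ge_at_top[of t0] by (rule eventually_mono) (rule m)
  have evM: "\<forall>\<^sub>F t in at_top. x t \<le> M"
    using eventually_ge_at_top[of t0] by (rule eventually_mono) (rule M)
  obtain L where L: "m \<le> L" "\<And>e. 0 < e \<Longrightarrow> \<forall>\<^sub>F t in at_top. x t < L + e"
      "\<And>e. 0 < e \<Longrightarrow> \<exists>\<^sub>F t in at_top. L - e < x t"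
    using real_limsup_exists[OF evm evM] by blast
  obtain l where l: "m \<le> l" "\<And>e. 0 < e \<Longrightarrow> \<forall>\<^sub>F t in at_top. l - e < x t"
      "\<And>e. 0 < e \<Longrightarrow> \<exists>\<^sub>F t in at_top. x t < l + e"
    using real_liminf_exists[OF evm evM] by blast
  have l0: "0 < l" using m l(1) by simp
  have lL: "l \<le> L"
  proof (rule field_le_epsilon)
    fix e :: real assume "0 < e"
    then show "l \<le> L + e"
      using eventually_happens[OF eventually_conj[OF L(2)[of "e / 2"] l(2)[of "e / 2"]]] by auto
  qed
  define c where "c = exp (\<delta> * \<zeta>) - 1"
  have c: "0 \<le> c" "exp (- (\<delta> * \<zeta>)) = 1 / (1 + c)"
    using small params by (auto simp: c_def exp_minus field_simps)
  have K: "a * K = ln (p / \<delta>)" using params by (simp add: K_def nicholson_equilibrium_def)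
  have "c * (a * K) \<le> 1" using small by (simp add: K c_def)
  moreover have "a * L \<le> a * K \<or> a * L * (1 + c - c * exp (a * K - a * l)) \<le> a * K"
  proof -
    have "L \<le> max K (L * exp (a * K - a * l) + (K - L * exp (a * K - a * l)) * exp (- \<delta> * \<zeta>))"
      by (rule limsup_estimate[OF \<zeta> _ L(2,3) l(2)]) (use L m in auto)
    moreover have "a * L * (1 + c - c * X) \<le> a * K" if "L \<le> L * X + (K - L * X) * (1 / (1 + c))" for X
    proof -
      have "L * (1 + c) \<le> (L * X + (K - L * X) * (1 / (1 + c))) * (1 + c)"
        using that c by (intro mult_right_mono) auto
      also have "\<dots> = K + c * L * X" using c by (simp add: field_simps)
      finally have "L * (1 + c - c * X) \<le> K" by (simp add: algebra_simps)
      then show ?thesis using params by (simp add: mult.assoc)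
    qed
    ultimately show ?thesis
      using params by (auto simp: c le_max_iff_disj)
  qed
  moreover have "a * K \<le> a * l \<or> a * K \<le> a * l * (1 + c - c * exp (a * K - a * L))"
  proof -
    have "min K (l * exp (a * K - a * L) + (K - l * exp (a * K - a * L)) * exp (- \<delta> * \<zeta>)) \<le> l"
      by (rule liminf_estimate[OF \<zeta> l0 l(2,3) L(2)])
    moreover have "a * K \<le> a * l * (1 + c - c * X)" if "l * X + (K - l * X) * (1 / (1 + c)) \<le> l" for X
    proof -
      have "K + c * l * X = (l * X + (K - l * X) * (1 / (1 + c))) * (1 + c)"
        using c by (simp add: field_simps)
      also have "\<dots> \<le> l * (1 + c)"
        using that c by (intro mult_right_mono) auto
      finally have "K \<le> l * (1 + c - c * X)" by (simp add: algebra_simps)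
      then show ?thesis using params by (simp add: mult.assoc)
    qed
    ultimately show ?thesis
      using params by (auto simp: c min_le_iff_disj)
  qed
  ultimately have "a * l = a * K" "a * L = a * K"
    using limits_collapse[of "a * K" c "a * l" "a * L"] params K_pos c l0 lL by simp_all
  then have lK: "l = K" "L = K" using params by auto
  show ?thesis
  proof (rule tendstoI)
    fix e :: real assume "0 < e"
    show "\<forall>\<^sub>F t in at_top. dist (x t) K < e"
      using L(2)[OF \<open>0 < e\<close>] l(2)[OF \<open>0 < e\<close>]
      by eventually_elim (auto simp: lK dist_real_def)
  qed
qed

end

section \<open>Positivity of solutions and global attractivity\<close>

text \<open>Before the first time \<open>m\<close> with \<open>x m \<le> 0\<close> all delayed
  values are nonnegative, so \<open>x\<close> decays at most exponentially from
  \<open>x t0 > 0\<close> and is still positive at \<open>m\<close>.\<close>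

lemma nicholson_solution_positive:
  fixes \<beta> \<sigma> \<tau> x :: "real \<Rightarrow> real"
  assumes "0 \<le> p" and cont: "continuous_on {t0..} \<beta>"
    and \<beta>: "\<And>t. t0 \<le> t \<Longrightarrow> 0 \<le> \<beta> t"
    and \<tau>: "\<And>t. t0 \<le> t \<Longrightarrow> 0 \<le> \<tau> t" "\<And>t. t0 \<le> t \<Longrightarrow> \<tau> t \<le> r"
    and init: "\<And>t. t0 - r \<le> t \<Longrightarrow> t \<le> t0 \<Longrightarrow> 0 \<le> x t" "0 < x t0"
    and deriv: "\<And>t. t0 \<le> t \<Longrightarrow> (x has_real_derivative
      \<beta> t * (p * x (t - \<tau> t) * exp (- a * x (t - \<sigma> t)) - \<delta> * x t)) (at t within {t0..})"
    and t: "t0 \<le> t"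
  shows "0 < x t"
proof (rule ccontr)
  assume no: "\<not> 0 < x t"
  have cont_x: "continuous_on {t0..} x" using deriv by (intro DERIV_continuous_on) auto
  then have cont_xt: "continuous_on {t0..s} x" for s by (rule continuous_on_subset) auto
  \<comment> \<open>Compactness of this set yields a first time at which \<open>x\<close> is not
    positive.\<close>
  define S where "S = {t0..t} \<inter> x -` {..0}"
  have "closed S" unfolding S_def
    by (intro continuous_closed_preimage cont_xt) auto
  then have "compact ({t0..t} \<inter> S)"
    by (intro compact_Int_closed) auto
  then have "compact S" by (simp add: S_def Int_absorb1)
  moreover have "S \<noteq> {}" using no t by (auto simp: S_def)
  ultimately obtain m where "m \<in> S" and min: "\<forall>z\<in>S. m \<le> z"
    using compact_attains_inf[of S] by metis
  then have m: "t0 \<le> m" "m \<le> t" "x m \<le> 0" by (auto simp: S_def)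
  have before: "0 < x z" if "t0 \<le> z" "z < m" for z
    using bspec[OF min, of z] that m(2) by (cases "x z \<le> 0") (auto simp: S_def)
  have "x t0 * exp (- \<delta> * integral {t0..m} \<beta>) \<le> x m"
  proof (rule exp_decay_lower_bound[OF m(1) cont_xt])
    show "continuous_on {t0..m} \<beta>" using cont by (rule continuous_on_subset) auto
    fix z assume z: "t0 < z" "z < m"
    show "(x has_real_derivative
      \<beta> z * (p * x (z - \<tau> z) * exp (- a * x (z - \<sigma> z)) - \<delta> * x z)) (at z)"
      using deriv[of z] z at_within_interior[of z "{t0..}"] by simp
    have "0 \<le> x (z - \<tau> z)"
      using before[of "z - \<tau> z"] init(1)[of "z - \<tau> z"] \<tau>[of z] z
      by (cases "t0 \<le> z - \<tau> z") auto
    then have "- (\<delta> * x z) \<le> p * x (z - \<tau> z) * exp (- a * x (z - \<sigma> z)) - \<delta> * x z"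
      using assms(1) by simp
    then have "\<beta> z * - (\<delta> * x z)
        \<le> \<beta> z * (p * x (z - \<tau> z) * exp (- a * x (z - \<sigma> z)) - \<delta> * x z)"
      using \<beta>[of z] z by (intro mult_left_mono) auto
    then show "- \<delta> * \<beta> z * x z
        \<le> \<beta> z * (p * x (z - \<tau> z) * exp (- a * x (z - \<sigma> z)) - \<delta> * x z)"
      by (simp add: mult_ac)
  qed
  moreover have "0 < x t0 * exp (- \<delta> * integral {t0..m} \<beta>)" using init by simp
  ultimately show False using m by linarith
qed

theorem theorem3p1:
  fixes t0 p a \<delta> :: real and \<beta> \<sigma> \<tau> :: "real \<Rightarrow> real"
  assumes "0 < p" "0 < a" "0 < \<delta>"
    and "continuous_on {t0..} \<beta>" "continuous_on {t0..} \<sigma>" "continuous_on {t0..} \<tau>"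
    and "\<And>t. t0 \<le> t \<Longrightarrow> 0 \<le> \<beta> t" "\<And>t. t0 \<le> t \<Longrightarrow> 0 \<le> \<sigma> t" "\<And>t. t0 \<le> t \<Longrightarrow> 0 \<le> \<tau> t"
    and "bounded (\<beta> ` {t0..})" "bounded (\<sigma> ` {t0..})" "bounded (\<tau> ` {t0..})"
    and "0 < (INF t\<in>{t0..}. \<beta> t)"
    and "\<delta> < p"
    and "(exp (\<delta> * zeta_M \<beta> \<sigma>) - 1) * ln (p / \<delta>) \<le> 1"
  shows "globally_attractive (admissible_initial (max_delay t0 \<tau> \<sigma>))
           (nicholson_solution t0 p a \<delta> \<beta> \<tau> \<sigma>) (nicholson_equilibrium p a \<delta>)"
  unfolding globally_attractive_def
proof (intro ballI allI impI)
  fix \<phi> x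
  define r where "r = max_delay t0 \<tau> \<sigma>"
  assume "\<phi> \<in> admissible_initial (max_delay t0 \<tau> \<sigma>)"
  then have \<phi>: "\<And>\<theta>. - r \<le> \<theta> \<Longrightarrow> \<theta> < 0 \<Longrightarrow> 0 \<le> \<phi> \<theta>" "0 < \<phi> 0"
    by (auto simp: admissible_initial_def r_def)
  assume "nicholson_solution t0 p a \<delta> \<beta> \<tau> \<sigma> \<phi> x"
  then have hist: "\<And>\<theta>. - r \<le> \<theta> \<Longrightarrow> \<theta> \<le> 0 \<Longrightarrow> x (t0 + \<theta>) = \<phi> \<theta>"
    and deriv: "\<And>t. t0 \<le> t \<Longrightarrow> (x has_real_derivative
      \<beta> t * (p * x (t - \<tau> t) * exp (- a * x (t - \<sigma> t)) - \<delta> * x t)) (at t within {t0..})"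
    by (auto simp: nicholson_solution_def r_def)
  have bdd: "bdd_above (\<sigma> ` {t0..})" "bdd_above (\<tau> ` {t0..})" "bdd_below (\<beta> ` {t0..})"
    using assms(10-12) by (auto intro: bounded_imp_bdd_above bounded_imp_bdd_below)
  have \<sigma>: "\<sigma> t \<le> r" if "t0 \<le> t" for t
    unfolding r_def max_delay_def using that by (intro max.coboundedI2 cSUP_upper bdd) auto
  have \<tau>: "\<tau> t \<le> r" if "t0 \<le> t" for t
    unfolding r_def max_delay_def using that by (intro max.coboundedI1 cSUP_upper bdd) auto
  have r: "0 \<le> r" using \<sigma>[of t0] assms(8)[of t0] by simp
  obtain b1 where b1: "\<And>t. t0 \<le> t \<Longrightarrow> \<bar>\<beta> t\<bar> \<le> b1"
    using assms(10) by (auto simp: bounded_iff)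
  \<comment> \<open>Admissibility gives nonnegativity before 0 and strict positivity at 0, hence the
    separate case \<open>t = t0\<close>.\<close>
  have init: "0 \<le> x t" if "t0 - r \<le> t" "t \<le> t0" for t
    using hist[of "t - t0"] \<phi>(1)[of "t - t0"] \<phi>(2) that by (cases "t = t0") auto
  have x0: "0 < x t0" using hist[of 0] \<phi>(2) r by simp
  interpret positive_nicholson_solution t0 r p a \<delta> "INF t\<in>{t0..}. \<beta> t" b1 \<beta> \<sigma> \<tau> x
  proof
    show "(INF t\<in>{t0..}. \<beta> t) \<le> \<beta> t" if "t0 \<le> t" for t
      using that by (intro cINF_lower bdd) auto
    show "\<beta> t \<le> b1" if "t0 \<le> t" for t using b1[OF that] by simp
    show "continuous_on {t0..} x" using deriv by (intro DERIV_continuous_on) auto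
    show "0 < x t" if "t0 \<le> t" for t
      using assms(1)
      by (intro nicholson_solution_positive[OF _ assms(4,7,9) \<tau> init x0 deriv that]) auto
    show "(x has_real_derivative
      \<beta> t * (p * x (t - \<tau> t) * exp (- a * x (t - \<sigma> t)) - \<delta> * x t)) (at t)" if "t0 + r < t" for t
      using deriv[of t] that r at_within_interior[of t "{t0..}"] by simp
  qed (use assms \<sigma> \<tau> r in auto)
  have zeta: "ereal (zeta_M \<beta> \<sigma>) = Limsup at_top (\<lambda>t. ereal (integral {t - \<sigma> t..t} \<beta>))"
    by (rule zeta_M_finite) (use assms in auto)
  have "(x \<longlongrightarrow> K) at_top"
  proof (rule tendsto_K)
    fix e :: real assume "0 < e"
    then have "Limsup at_top (\<lambda>t. ereal (integral {t - \<sigma> t..t} \<beta>)) < ereal (zeta_M \<beta> \<sigma> + e)"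
      by (simp flip: zeta)
    then show "\<forall>\<^sub>F t in at_top. integral {t - \<sigma> t..t} \<beta> < zeta_M \<beta> \<sigma> + e"
      using Limsup_lessD by fastforce
  next
    \<comment> \<open>From \<open>t0 + r\<close> on, the interval of integration lies in
      \<open>[t0, \<infinity>)\<close>, where \<open>\<beta>\<close> is nonnegative.\<close>
    have "\<forall>\<^sub>F t in at_top. 0 \<le> ereal (integral {t - \<sigma> t..t} \<beta>)"
      using eventually_ge_at_top[of "t0 + r"]
    proof eventually_elim
      case (elim t)
      then show ?case
        using delayed_ge(1)[of t0 t] assms(8)[of t] r by (auto intro!: integral_bounds)
    qed
    then have "0 \<le> ereal (zeta_M \<beta> \<sigma>)" unfolding zeta by (intro le_Limsup) auto
    then show "0 \<le> zeta_M \<beta> \<sigma>" by simp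
  qed fact
  then show "(x \<longlongrightarrow> nicholson_equilibrium p a \<delta>) at_top" by (simp add: K_def)
qed

end
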